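(* Let $k,m,t$ be positive integers with $k\ge 2$, $t,m\ge 2$, and let $r=k+m-1$. Then \[ \tilde R_t(P_r^{(k)})\le |Q_k|\cdot|Q_{k-1}|\prod_{i=1}^{k-1}a_i, \] where $a_i$ is the size of a largest antichain in $Q_i$. Moreover, for any constant $\varepsilon>0$, \[ |Q_3|\cdot|Q_2|\,a_2a_1\le |Q_3|(\lg|Q_3|)^{2+\frac1{t-1}+\varepsilon} \quad\text{and}\quad |Q_k|\cdot|Q_{k-1}|\prod_{i=1}^{k-1}a_i\le |Q_k|(\lg|Q_k|)^{2+\varepsilon}\ \ (\text{for } k\ge4) \] whenever $tm$ is sufficiently large in terms of $\varepsilon$.
   Context: $\lg$ is the base-2 logarithm. $Q_1$ is the poset that is the disjoint union of $t$ chains each with $m-1$ elements; for $j>1$, $Q_j$ is the poset of all down-sets (including the empty set) of $Q_{j-1}$, ordered by inclusion. The monotone tight path $P_r^{(k)}$ is the ordered $k$-uniform hypergraph on $[r]$ whose edges are all $k$-sets of consecutive vertices (it has $m=r-k+1$ edges). The $t$-color on-line size Ramsey number $\tilde R_t(G)$ of an ordered hypergraph $G$ is the minimum number of rounds Builder needs to guarantee a win in the following game: on a large linearly ordered vertex supply, each round Builder presents a new $k$-set and Painter immediately colors it with one of $t$ colors; Builder wins when a monochromatic copy of $G$ respecting the vertex order appears. *)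

theory Defs
  imports Complex_Main "HOL-Library.FSet" "HOL-Library.Extended_Nat"
begin

text \<open>
  All posets \<open>Q\<^sub>1, Q\<^sub>2, \<dots>\<close> live in one type: \<open>Pt c a\<close> is the element at height \<open>a\<close> of chain \<open>c\<close>,
  and \<open>Down D\<close> is the set \<open>D\<close> regarded as an element of the next poset.  As every \<open>Q\<^sub>j\<close> is finite,
  finite sets suffice.
\<close>

datatype qelem = Pt nat nat | Down "qelem fset"

fun q_le :: "qelem \<Rightarrow> qelem \<Rightarrow> bool" where
  "q_le (Pt c a) (Pt d b) \<longleftrightarrow> c = d \<and> a \<le> b"
| "q_le (Down A) (Down B) \<longleftrightarrow> A |\<subseteq>| B"
| "q_le _ _ \<longleftrightarrow> False"

definition down_set_of :: "qelem set \<Rightarrow> qelem set \<Rightarrow> bool" where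
  "down_set_of P D \<longleftrightarrow> D \<subseteq> P \<and> (\<forall>x\<in>D. \<forall>y\<in>P. q_le y x \<longrightarrow> y \<in> D)"

text \<open>The index starts at 1; the value at 0 is a dummy.\<close>

fun Q :: "nat \<Rightarrow> nat \<Rightarrow> nat \<Rightarrow> qelem set" where
  "Q t m 0 = {}"
| "Q t m (Suc 0) = {Pt c a | c a. c < t \<and> a < m - 1}"
| "Q t m (Suc (Suc j)) = {Down D | D. down_set_of (Q t m (Suc j)) (fset D)}"

definition antichain :: "qelem set \<Rightarrow> bool" where
  "antichain A \<longleftrightarrow> (\<forall>x\<in>A. \<forall>y\<in>A. x \<noteq> y \<longrightarrow> \<not> q_le x y)"

definition max_antichain :: "nat \<Rightarrow> nat \<Rightarrow> nat \<Rightarrow> nat" where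
  "max_antichain t m i = Max {card A | A. A \<subseteq> Q t m i \<and> antichain A}"

text \<open>An ordered hypergraph is a pair of a vertex set and an edge set.\<close>

type_synonym ordered_hypergraph = "nat set \<times> nat set set"

definition tight_path :: "nat \<Rightarrow> nat \<Rightarrow> ordered_hypergraph" where
  "tight_path k r = ({1..r}, {{i..<i + k} | i. 1 \<le> i \<and> i + k \<le> r + 1})"

text \<open>
  A position of the game is the partial map assigning to each presented edge its colour in
  \<open>{..<t}\<close>; the vertex supply is \<open>{1..N}\<close>.
\<close>

definition mono_copy ::
  "ordered_hypergraph \<Rightarrow> nat \<Rightarrow> nat \<Rightarrow> (nat set \<rightharpoonup> nat) \<Rightarrow> bool" where
  "mono_copy G t N pos \<longleftrightarrow>
     (\<exists>col<t. \<exists>f. strict_mono_on (fst G) f \<and> f ` fst G \<subseteq> {1..N} \<and>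
        (\<forall>e\<in>snd G. pos (f ` e) = Some col))"

text \<open>
  \<open>builder_wins k G t N s pos\<close>: from position \<open>pos\<close>, Builder can force a monochromatic copy
  of \<open>G\<close> within at most \<open>s\<close> further rounds.
\<close>

primrec builder_wins ::
  "nat \<Rightarrow> ordered_hypergraph \<Rightarrow> nat \<Rightarrow> nat \<Rightarrow> nat \<Rightarrow> (nat set \<rightharpoonup> nat) \<Rightarrow> bool" where
  "builder_wins k G t N 0 pos \<longleftrightarrow> mono_copy G t N pos"
| "builder_wins k G t N (Suc s) pos \<longleftrightarrow> mono_copy G t N pos \<or>
     (\<exists>e. e \<subseteq> {1..N} \<and> card e = k \<and> e \<notin> dom pos \<and>
        (\<forall>col<t. builder_wins k G t N s (pos(e \<mapsto> col))))"

text \<open>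
  ``Large vertex supply'' means every sufficiently large \<open>N\<close>.  The value is \<open>\<infinity>\<close> if Builder has
  no winning strategy with a bounded number of rounds.
\<close>

definition online_size_ramsey :: "nat \<Rightarrow> nat \<Rightarrow> ordered_hypergraph \<Rightarrow> enat" where
  "online_size_ramsey k t G =
     (INF s \<in> {s. \<forall>\<^sub>F N in sequentially. builder_wins k G t N s Map.empty}. enat s)"

end

theory Submission
  imports Defs "HOL-Library.FuncSet" "HOL-Real_Asymp.Real_Asymp"
begin

text \<open>
  Label a list of \<open>k - 1\<close> vertices by the set of pairs (colour, length) of monochromatic paths ending
  there, and label a shorter list \<open>xs\<close> by the down-set generated by the labels of all \<open>u # xs\<close>; thus a
  list of \<open>k - i\<close> vertices has a label in \<open>Q\<^bsub>i+1\<^esub>\<close>, and a single vertex one in \<open>Q\<^sub>k\<close>.  Builder handles the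
  vertices from left to right.  While the current vertex \<open>v\<close> has the same label as an earlier \<open>u\<close>, at
  most \<open>a\<^sub>2 \<cdots> a\<^bsub>k-1\<^esub>\<close> edges ending in \<open>u, v\<close> force the label of \<open>v\<close>, a down-set of \<open>Q\<^bsub>k-1\<^esub>\<close>, to grow, so
  after at most \<open>|Q\<^bsub>k-1\<^esub>|\<close> such steps \<open>v\<close> has a new label, and there are only \<open>|Q\<^sub>k|\<close> labels.  The factor
  \<open>a\<^sub>1 \<ge> 2\<close> absorbs the cost of the last vertex.

  The estimates follow from \<open>2 ^ a\<^sub>j \<le> |Q\<^bsub>j+1\<^esub>| \<le> (|Q\<^sub>j| + 1) a\<^bsub>j+1\<^esub>\<close> and \<open>m ^ t \<le> |Q\<^sub>2|\<close>.
\<close>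

section \<open>The posets\<close>

lemma q_le_refl: "q_le x x"
  by (cases x) auto

lemma q_le_trans: "q_le x y \<Longrightarrow> q_le y z \<Longrightarrow> q_le x z"
  by (cases x; cases y; cases z) auto

lemma finite_Q: "finite (Q t m j)"
proof (induction j rule: induct_nat_012)
  case 1
  have "Q t m (Suc 0) \<subseteq> (\<lambda>(c, a). Pt c a) ` ({..<t} \<times> {..<m - 1})"
    by auto
  then show ?case
    by (rule finite_subset) auto
next
  case (ge2 j)
  have "Q t m (Suc (Suc j)) \<subseteq> (\<lambda>S. Down (Abs_fset S)) ` Pow (Q t m (Suc j))"
  proof
    fix x assume "x \<in> Q t m (Suc (Suc j))"
    then obtain D where "x = Down D" "fset D \<subseteq> Q t m (Suc j)"
      by (auto simp: down_set_of_def)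
    then show "x \<in> (\<lambda>S. Down (Abs_fset S)) ` Pow (Q t m (Suc j))"
      by (intro image_eqI[of _ _ "fset D"]) (auto simp: fset_inverse)
  qed
  then show ?case
    by (rule finite_subset) (use ge2 in auto)
qed auto

lemma card_Q_1: "card (Q t m 1) = t * (m - 1)"
proof -
  have "Q t m 1 = (\<lambda>(c, a). Pt c a) ` ({..<t} \<times> {..<m - 1})"
    by auto
  moreover have "inj_on (\<lambda>(c, a). Pt c a) ({..<t} \<times> {..<m - 1})"
    by (auto simp: inj_on_def)
  ultimately show ?thesis
    by (simp add: card_image)
qed

text \<open>\<open>Abs_fset\<close> is meaningful on finite sets only. Down-sets of the posets are
  finite, so they can be handled as plain sets and wrapped only when compared as elements of the
  next poset.\<close>

definition down_elem :: "qelem set \<Rightarrow> qelem" where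
  "down_elem S = Down (Abs_fset S)"

lemma q_le_down_elem:
  assumes "finite S" "finite T"
  shows "q_le (down_elem S) (down_elem T) \<longleftrightarrow> S \<subseteq> T"
  using assms by (simp add: down_elem_def less_eq_fset.rep_eq Abs_fset_inverse)

lemma down_set_of_finite: "down_set_of (Q t m j) S \<Longrightarrow> finite S"
  unfolding down_set_of_def using finite_Q finite_subset by blast

text \<open>Turns counts of down-sets into sizes of posets. Index 0 is excluded because
  \<open>Q t m 1\<close> is not built from the dummy \<open>Q t m 0\<close>.\<close>

lemma bij_betw_down_elem:
  assumes "j \<ge> 1"
  shows "bij_betw down_elem {S. down_set_of (Q t m j) S} (Q t m (Suc j))"
proof -
  obtain i where j: "j = Suc i"
    using assms by (cases j) auto
  have "inj_on down_elem {S. down_set_of (Q t m j) S}"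
    using down_set_of_finite by (intro inj_onI) (metis mem_Collect_eq q_le_down_elem q_le_refl subset_antisym)
  moreover have "down_elem ` {S. down_set_of (Q t m j) S} = Q t m (Suc j)"
  proof (intro equalityI subsetI)
    fix x assume "x \<in> down_elem ` {S. down_set_of (Q t m j) S}"
    then obtain S where "x = Down (Abs_fset S)" "down_set_of (Q t m j) S"
      by (auto simp: down_elem_def)
    then show "x \<in> Q t m (Suc j)"
      using down_set_of_finite[of t m j S] by (auto simp: j Abs_fset_inverse)
  next
    fix x assume "x \<in> Q t m (Suc j)"
    then obtain D where "x = Down D" "down_set_of (Q t m j) (fset D)"
      by (auto simp: j)
    then show "x \<in> down_elem ` {S. down_set_of (Q t m j) S}"
      by (intro image_eqI[of _ _ "fset D"]) (auto simp: down_elem_def fset_inverse)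
  qed
  ultimately show ?thesis
    by (simp add: bij_betw_def)
qed

lemma down_elem_in_Q:
  "j \<ge> 1 \<Longrightarrow> down_set_of (Q t m j) S \<Longrightarrow> down_elem S \<in> Q t m (Suc j)"
  using bij_betw_down_elem[of j t m] by (auto simp: bij_betw_def)

section \<open>Largest antichains and sizes of the posets\<close>

lemma finite_antichain_cards: "finite {card A | A. A \<subseteq> Q t m i \<and> antichain A}"
proof -
  have "{card A | A. A \<subseteq> Q t m i \<and> antichain A} \<subseteq> card ` Pow (Q t m i)"
    by auto
  then show ?thesis
    by (rule finite_subset) (simp add: finite_Q)
qed

lemma card_le_max_antichain:
  "A \<subseteq> Q t m i \<Longrightarrow> antichain A \<Longrightarrow> card A \<le> max_antichain t m i"
  unfolding max_antichain_def by (intro Max_ge finite_antichain_cards) auto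

lemma max_antichain_attained:
  obtains A where "A \<subseteq> Q t m i" "antichain A" "card A = max_antichain t m i"
proof -
  have "antichain {}"
    by (simp add: antichain_def)
  then have "{card A | A. A \<subseteq> Q t m i \<and> antichain A} \<noteq> {}"
    by blast
  then have "max_antichain t m i \<in> {card A | A. A \<subseteq> Q t m i \<and> antichain A}"
    unfolding max_antichain_def using finite_antichain_cards Max_in by blast
  then show ?thesis
    using that by auto
qed

lemma max_antichain_le_card: "max_antichain t m i \<le> card (Q t m i)"
  by (metis max_antichain_attained card_mono finite_Q)

lemma max_antichain_1_ge:
  assumes "t \<ge> 2" "m \<ge> 2"
  shows "max_antichain t m 1 \<ge> 2"
proof -
  have "card {Pt 0 0, Pt 1 0} \<le> max_antichain t m 1"
    using assms by (intro card_le_max_antichain) (auto simp: antichain_def)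
  then show ?thesis
    by simp
qed

text \<open>Two points of one chain are comparable, so the chain index is injective on an
  antichain.\<close>

lemma max_antichain_1_le: "max_antichain t m 1 \<le> t"
proof -
  obtain A where A: "A \<subseteq> Q t m 1" "antichain A" "card A = max_antichain t m 1"
    by (rule max_antichain_attained)
  \<comment> \<open>No \<open>Down\<close> element occurs in \<open>Q t m 1\<close>; the value 0 for
    it is arbitrary.\<close>
  define chain where "chain x = (case x of Pt c a \<Rightarrow> c | Down D \<Rightarrow> 0)" for x
  have "inj_on chain A"
  proof (rule inj_onI)
    fix x y assume xy: "x \<in> A" "y \<in> A" "chain x = chain y"
    then obtain c a b where "x = Pt c a" "y = Pt c b"
      using A(1) by (fastforce simp: chain_def)
    then show "x = y"
      using xy A(2) unfolding antichain_def by (metis nle_le q_le.simps(1))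
  qed
  moreover have "chain ` A \<subseteq> {..<t}"
    using A(1) by (auto simp: chain_def)
  ultimately have "card A \<le> card {..<t}"
    by (intro card_inj_on_le) auto
  then show ?thesis
    using A by simp
qed

text \<open>Every subset of a largest antichain generates a down-set and is recovered from it by
  intersection with the antichain, so distinct subsets generate distinct down-sets.\<close>

lemma two_power_max_antichain_le:
  assumes "j \<ge> 1"
  shows "2 ^ max_antichain t m j \<le> card (Q t m (Suc j))"
proof -
  obtain A where A: "A \<subseteq> Q t m j" "antichain A" "card A = max_antichain t m j"
    by (rule max_antichain_attained)
  define gen where "gen B = {y \<in> Q t m j. \<exists>x\<in>B. q_le y x}" for B
  have "B = gen B \<inter> A" if "B \<subseteq> A" for B
  proof (intro equalityI subsetI)
    fix x assume "x \<in> B"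
    then show "x \<in> gen B \<inter> A"
      using that A(1) q_le_refl[of x] by (auto simp: gen_def)
  next
    fix x assume x: "x \<in> gen B \<inter> A"
    then obtain y where "y \<in> B" "q_le x y"
      by (auto simp: gen_def)
    then show "x \<in> B"
      using that x A(2) unfolding antichain_def by (metis IntD2 subsetD)
  qed
  then have "inj_on gen (Pow A)"
    by (metis PowD inj_onI)
  moreover have "gen ` Pow A \<subseteq> {S. down_set_of (Q t m j) S}"
    by (auto simp: gen_def down_set_of_def intro: q_le_trans)
  moreover have "finite {S. down_set_of (Q t m j) S}"
    by (rule finite_subset[of _ "Pow (Q t m j)"]) (auto simp: down_set_of_def finite_Q)
  ultimately have "card (Pow A) \<le> card {S. down_set_of (Q t m j) S}"
    by (rule card_inj_on_le)
  also have "\<dots> = card (Q t m (Suc j))"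
    by (rule bij_betw_same_card[OF bij_betw_down_elem[OF assms]])
  finally show ?thesis
    using A finite_Q finite_subset by (metis card_Pow)
qed

text \<open>Down-sets of equal size form an antichain, and there are only \<open>|Q\<^sub>j| + 1\<close> sizes.\<close>

lemma card_Q_Suc_le:
  assumes "j \<ge> 1"
  shows "card (Q t m (Suc j)) \<le> (card (Q t m j) + 1) * max_antichain t m (Suc j)"
proof -
  let ?DS = "{S. down_set_of (Q t m j) S}"
  define level where "level n = down_elem ` {S \<in> ?DS. card S = n}" for n
  have Q_eq: "Q t m (Suc j) = down_elem ` ?DS"
    using bij_betw_down_elem[OF assms] by (simp add: bij_betw_def)
  have "card S \<le> card (Q t m j)" if "down_set_of (Q t m j) S" for S
    using that by (intro card_mono finite_Q) (auto simp: down_set_of_def)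
  then have union: "Q t m (Suc j) = (\<Union>n\<le>card (Q t m j). level n)"
    by (auto simp: Q_eq level_def)
  have "card (level n) \<le> max_antichain t m (Suc j)" for n
  proof (rule card_le_max_antichain)
    show "level n \<subseteq> Q t m (Suc j)"
      by (auto simp: Q_eq level_def)
    show "antichain (level n)"
      unfolding antichain_def
    proof (intro ballI impI notI)
      fix x y assume xy: "x \<in> level n" "y \<in> level n" "x \<noteq> y" "q_le x y"
      then obtain S T where "x = down_elem S" "y = down_elem T" "card S = n" "card T = n"
          "finite S" "finite T"
        using down_set_of_finite[of t m j] by (auto simp: level_def)
      then show False
        using xy(3,4) card_subset_eq[of T S] by (auto simp: q_le_down_elem)
    qed
  qed
  then have "(\<Sum>n\<le>card (Q t m j). card (level n)) \<le> card {..card (Q t m j)} * max_antichain t m (Suc j)"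
    by (intro sum_bounded_above[where 'a = nat, simplified])
  moreover have "card (Q t m (Suc j)) \<le> (\<Sum>n\<le>card (Q t m j). card (level n))"
    unfolding union by (rule card_UN_le) simp
  ultimately show ?thesis
    by simp
qed

text \<open>A down-set of disjoint chains is determined by how many elements it keeps of each chain,
  a number from 0 to \<open>m - 1\<close>; the functions \<open>f\<close> in the proof list these
  numbers.\<close>

lemma power_le_card_Q_2:
  assumes "m \<ge> 1"
  shows "m ^ t \<le> card (Q t m 2)"
proof -
  define S where "S f = {Pt c a | c a. c < t \<and> a < f c}" for f :: "nat \<Rightarrow> nat"
  have "inj_on S ({..<t} \<rightarrow>\<^sub>E {..<m})"
  proof (rule inj_onI)
    fix f g assume fg: "f \<in> {..<t} \<rightarrow>\<^sub>E {..<m}" "g \<in> {..<t} \<rightarrow>\<^sub>E {..<m}" "S f = S g"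
    have "a < f c \<longleftrightarrow> a < g c" if "c < t" for a c
      using fg(3) that by (auto simp: S_def set_eq_iff)
    then have "f c = g c" if "c < t" for c
      using that by (metis linorder_neqE_nat order_less_irrefl)
    then show "f = g"
      using fg by (intro PiE_ext) auto
  qed
  moreover have "S ` ({..<t} \<rightarrow>\<^sub>E {..<m}) \<subseteq> {D. down_set_of (Q t m 1) D}"
  proof (intro image_subsetI CollectI)
    fix f assume "f \<in> {..<t} \<rightarrow>\<^sub>E {..<m}"
    then have "f c \<le> m - 1" if "c < t" for c
      using that PiE_mem[of f "{..<t}" "\<lambda>_. {..<m}" c] by auto
    then have "S f \<subseteq> Q t m 1"
      by (fastforce simp: S_def)
    moreover have "y \<in> S f" if "x \<in> S f" "q_le y x" for x y
      using that by (cases y) (auto simp: S_def)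
    ultimately show "down_set_of (Q t m 1) (S f)"
      by (auto simp: down_set_of_def simp del: Q.simps)
  qed
  moreover have "finite {D. down_set_of (Q t m 1) D}"
    by (rule finite_subset[of _ "Pow (Q t m 1)"]) (auto simp: down_set_of_def finite_Q simp del: Q.simps)
  ultimately have "card ({..<t} \<rightarrow>\<^sub>E {..<m}) \<le> card {D. down_set_of (Q t m 1) D}"
    by (rule card_inj_on_le)
  also have "\<dots> = card (Q t m (Suc 1))"
    by (rule bij_betw_same_card[OF bij_betw_down_elem]) simp
  finally show ?thesis
    by (simp add: card_PiE numeral_2_eq_2)
qed

section \<open>The game\<close>

text \<open>
  \<open>tpath pos c n xs\<close>: some tight path with \<open>n\<close> edges, all of colour \<open>c\<close>, ends in the
  vertices \<open>xs\<close>, where \<open>xs\<close> lists \<open>k - 1\<close> vertices in increasing order.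
\<close>

primrec tpath :: "(nat set \<rightharpoonup> nat) \<Rightarrow> nat \<Rightarrow> nat \<Rightarrow> nat list \<Rightarrow> bool" where
  "tpath pos c 0 xs \<longleftrightarrow> True"
| "tpath pos c (Suc n) xs \<longleftrightarrow> (\<exists>u. 0 < u \<and> u < hd xs \<and> pos (set (u # xs)) = Some c \<and>
     tpath pos c n (butlast (u # xs)))"

section \<open>Monochromatic tight paths\<close>

lemma tpath_Suc_imp: "tpath pos c (Suc n) xs \<Longrightarrow> tpath pos c n xs"
proof (induction n arbitrary: xs)
  case (Suc n)
  obtain u where u: "0 < u" "u < hd xs" "pos (set (u # xs)) = Some c"
      "tpath pos c (Suc n) (butlast (u # xs))"
    using Suc.prems by (subst (asm) tpath.simps) (elim exE conjE)
  then show ?case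
    using Suc.IH[OF u(4)] by auto
qed simp

lemma tpath_mono: "tpath pos c n xs \<Longrightarrow> n' \<le> n \<Longrightarrow> tpath pos c n' xs"
proof (induction n)
  case (Suc n)
  then show ?case
    using tpath_Suc_imp le_Suc_eq by metis
qed simp

lemma tpath_extend:
  "pos \<subseteq>\<^sub>m pos' \<Longrightarrow> tpath pos c n xs \<Longrightarrow> tpath pos' c n xs"
proof (induction n arbitrary: xs)
  case (Suc n)
  obtain u where u: "0 < u" "u < hd xs" "pos (set (u # xs)) = Some c" "tpath pos c n (butlast (u # xs))"
    using Suc.prems(2) by auto
  have "pos' (set (u # xs)) = Some c"
    using u(3) Suc.prems(1) by (metis domI map_le_def)
  then show ?case
    using u Suc.IH[OF Suc.prems(1)] by auto
qed simp

text \<open>The recursion only prepends vertices below \<open>hd xs\<close>, so it never consults an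
  edge outside \<open>{..v}\<close>. Nonemptiness makes \<open>hd xs\<close> an actual member of the
  list.\<close>

lemma tpath_local:
  "\<forall>e\<subseteq>{..v}. pos e = pos' e \<Longrightarrow> xs \<noteq> [] \<Longrightarrow> set xs \<subseteq> {..v} \<Longrightarrow>
     tpath pos c n xs = tpath pos' c n xs"
proof (induction n arbitrary: xs)
  case (Suc n)
  have "pos (set (u # xs)) = pos' (set (u # xs)) \<and>
      tpath pos c n (butlast (u # xs)) = tpath pos' c n (butlast (u # xs))" if "u < hd xs" for u
  proof -
    have "hd xs \<le> v"
      using Suc.prems(2,3) hd_in_set by blast
    then have sub: "set (u # xs) \<subseteq> {..v}"
      using that Suc.prems(3) by auto
    have "set (butlast (u # xs)) \<subseteq> {..v}"
      using sub by (meson in_set_butlastD subset_iff)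
    moreover have "butlast (u # xs) \<noteq> []"
      using Suc.prems(2) by simp
    ultimately show ?thesis
      using Suc.IH[OF Suc.prems(1)] Suc.prems(1) sub by blast
  qed
  then show ?case
    by (simp only: tpath.simps) metis
qed simp

text \<open>Prescribing the last \<open>p\<close> values of \<open>f\<close> carries the induction:
  the shorter path ends in \<open>butlast (u # xs)\<close>, so only the vertex
  \<open>last xs\<close> remains to be appended.\<close>

lemma tpath_embedding:
  assumes "tpath pos c n xs" "length xs = p" "p > 0" "sorted_wrt (<) xs" "set xs \<subseteq> {1..N}"
  shows "\<exists>f. strict_mono_on {1..n + p} f \<and> f ` {1..n + p} \<subseteq> {1..N} \<and>
    (\<forall>i\<in>{1..n}. pos (f ` {i..<i + Suc p}) = Some c) \<and> (\<forall>j<p. f (n + 1 + j) = xs ! j)"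
  using assms
proof (induction n arbitrary: xs)
  case 0
  have "strict_mono_on {1..p} (\<lambda>i. xs ! (i - 1))"
    using 0 by (auto simp: strict_mono_on_def sorted_wrt_iff_nth_less)
  moreover have "(\<lambda>i. xs ! (i - 1)) ` {1..p} \<subseteq> {1..N}"
  proof (rule image_subsetI)
    fix i assume "i \<in> {1..p}"
    then have "xs ! (i - 1) \<in> set xs"
      using 0 by auto
    then show "xs ! (i - 1) \<in> {1..N}"
      using 0 by blast
  qed
  ultimately show ?case
    by (intro exI[of _ "\<lambda>i. xs ! (i - 1)"]) auto
next
  case (Suc n)
  obtain u where u: "0 < u" "u < hd xs" "pos (set (u # xs)) = Some c" "tpath pos c n (butlast (u # xs))"
    using Suc.prems(1) by auto
  let ?ys = "u # xs"
  obtain x xs' where xs: "xs = x # xs'"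
    using Suc.prems by (cases xs) auto
  have sorted: "sorted_wrt (<) ?ys"
    using u Suc.prems(4) by (auto simp: xs)
  have sub: "set ?ys \<subseteq> {1..N}"
    using u Suc.prems(5) by (auto simp: xs)
  have init: "sorted_wrt (<) (butlast ?ys)" "set (butlast ?ys) \<subseteq> {1..N}" "length (butlast ?ys) = p"
  proof -
    show "sorted_wrt (<) (butlast ?ys)"
      using sorted unfolding butlast_conv_take by (rule sorted_wrt_take)
    show "set (butlast ?ys) \<subseteq> {1..N}"
      using sub by (meson in_set_butlastD subset_iff)
    show "length (butlast ?ys) = p"
      using Suc.prems(2) by (simp only: length_butlast length_Cons diff_Suc_1)
  qed
  obtain f where f: "strict_mono_on {1..n + p} f" "f ` {1..n + p} \<subseteq> {1..N}"
      "\<forall>i\<in>{1..n}. pos (f ` {i..<i + Suc p}) = Some c" "\<forall>j<p. f (n + 1 + j) = butlast ?ys ! j"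
    using Suc.IH[OF u(4) init(3) Suc.prems(3) init(1,2)] by (elim exE conjE)
  define g where "g = f(n + p + 1 := last xs)"
  have g_end: "g (n + 1 + j) = ?ys ! j" if "j < Suc p" for j
  proof (cases "j = p")
    case True
    then show ?thesis
      using Suc.prems(2,3) by (auto simp: g_def last_conv_nth)
  next
    case False
    then show ?thesis
      using that f(4) Suc.prems(2) by (auto simp: g_def nth_butlast simp del: butlast.simps)
  qed
  have g_old: "g i = f i" if "i \<le> n + p" for i
    using that by (simp add: g_def)
  have last_less: "g (n + p) < g (n + p + 1)"
  proof -
    have "?ys ! (p - 1) < ?ys ! p"
      using sorted Suc.prems(2,3) unfolding sorted_wrt_iff_nth_less by auto
    moreover have "n + 1 + (p - 1) = n + p"
      using Suc.prems(3) by simp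
    ultimately show ?thesis
      using g_end[of "p - 1"] g_end[of p] Suc.prems(3) by (simp add: add_ac)
  qed
  have mono: "strict_mono_on {1..Suc n + p} g"
  proof (rule strict_mono_onI)
    fix a b assume ab: "a \<in> {1..Suc n + p}" "b \<in> {1..Suc n + p}" "a < b"
    show "g a < g b"
    proof (cases "b = n + p + 1")
      case True
      have "g a \<le> g (n + p)"
        using ab True g_old strict_mono_onD[OF f(1), of a "n + p"] by (cases "a = n + p") auto
      then show ?thesis
        using last_less True by simp
    next
      case False
      then show ?thesis
        using ab g_old strict_mono_onD[OF f(1), of a b] by auto
    qed
  qed
  have range: "g ` {1..Suc n + p} \<subseteq> {1..N}"
  proof (rule image_subsetI)
    fix i assume i: "i \<in> {1..Suc n + p}"
    have "last xs \<in> {1..N}"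
      using Suc.prems(5) by (metis last_in_set list.distinct(1) subsetD xs)
    moreover have "f i \<in> {1..N}" if "i \<le> n + p"
      using f(2) i that by (auto simp: image_subset_iff)
    ultimately show "g i \<in> {1..N}"
      using i by (auto simp: g_def)
  qed
  have edges: "pos (g ` {i..<i + Suc p}) = Some c" if "i \<in> {1..Suc n}" for i
  proof (cases "i = Suc n")
    case True
    have "{i..<i + Suc p} = (\<lambda>j. n + 1 + j) ` {..<Suc p}"
      using True image_add_atLeastLessThan[of "n + 1" 0 "Suc p"]
      by (simp add: atLeast0LessThan add_ac)
    then have "g ` {i..<i + Suc p} = (\<lambda>j. g (n + 1 + j)) ` {..<Suc p}"
      by (simp only: image_image)
    also have "\<dots> = (\<lambda>j. ?ys ! j) ` {..<Suc p}"
      using g_end by (intro image_cong) auto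
    also have "\<dots> = set ?ys"
      using Suc.prems(2) nth_image[of "Suc p" ?ys] by (simp add: atLeast0LessThan del: nth_Cons_Suc)
    finally show ?thesis
      using u(3) by simp
  next
    case False
    then have "g ` {i..<i + Suc p} = f ` {i..<i + Suc p}"
      using that by (intro image_cong g_old) auto
    then show ?thesis
      using f(3) False that by auto
  qed
  have "g (Suc n + 1 + j) = xs ! j" if "j < p" for j
    using g_end[of "Suc j"] that by simp
  then show ?case
    using mono range edges by blast
qed

lemma mono_copy_of_tpath:
  assumes "tpath pos c m xs" "c < t" "length xs = k - 1" "k \<ge> 2" "m \<ge> 1"
    "sorted_wrt (<) xs" "set xs \<subseteq> {1..N}"
  shows "mono_copy (tight_path k (k + m - 1)) t N pos"
proof -
  obtain f where f: "strict_mono_on {1..m + (k - 1)} f" "f ` {1..m + (k - 1)} \<subseteq> {1..N}"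
      "\<forall>i\<in>{1..m}. pos (f ` {i..<i + Suc (k - 1)}) = Some c"
    using tpath_embedding[OF assms(1,3) _ assms(6,7)] assms(4) by auto
  have k: "m + (k - 1) = k + m - 1" "Suc (k - 1) = k"
    using assms by auto
  show ?thesis
    unfolding mono_copy_def tight_path_def
    using f assms(2,5) unfolding k by (intro exI[of _ c] conjI exI[of _ f]) auto
qed

text \<open>
  The label of a list \<open>xs\<close> of \<open>k - i\<close> vertices, as a down-set of \<open>Q\<^sub>i\<close>.
\<close>

fun reach :: "nat \<Rightarrow> nat \<Rightarrow> (nat set \<rightharpoonup> nat) \<Rightarrow> nat \<Rightarrow> nat list \<Rightarrow> qelem set" where
  "reach t m pos 0 xs = {}"
| "reach t m pos (Suc 0) xs = {Pt c a | c a. c < t \<and> a < m - 1 \<and> tpath pos c (Suc a) xs}"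
| "reach t m pos (Suc (Suc i)) xs = {y \<in> Q t m (Suc (Suc i)).
     \<exists>u. 0 < u \<and> u < hd xs \<and> q_le y (down_elem (reach t m pos (Suc i) (u # xs)))}"

section \<open>Labels of vertex lists\<close>

text \<open>This makes \<open>down_elem\<close> of a label an element of the next poset. At level 1
  a long path contains shorter ones with the same end; higher levels are closed downwards by
  construction.\<close>

lemma down_set_of_reach:
  "down_set_of (Q t m i) (reach t m pos i xs)"
proof (induction i arbitrary: xs rule: induct_nat_012)
  case 1
  show ?case
    unfolding down_set_of_def
  proof (intro conjI ballI impI)
    show "reach t m pos (Suc 0) xs \<subseteq> Q t m (Suc 0)"
      by auto
    fix x y assume "x \<in> reach t m pos (Suc 0) xs" "q_le y x"
    moreover from this obtain c a where "x = Pt c a" "c < t" "a < m - 1" "tpath pos c (Suc a) xs"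
      by auto
    moreover from calculation obtain b where "y = Pt c b" "b \<le> a"
      by (cases y) auto
    moreover have "tpath pos c (Suc b) xs"
      using calculation by (intro tpath_mono[of pos c "Suc a" xs "Suc b"]) auto
    ultimately show "y \<in> reach t m pos (Suc 0) xs"
      by auto
  qed
next
  case (ge2 i)
  show ?case
    by (auto simp: down_set_of_def simp del: Q.simps intro: q_le_trans)
qed (simp add: down_set_of_def)

lemma finite_reach: "finite (reach t m pos i xs)"
  using down_set_of_finite down_set_of_reach by blast

text \<open>New edges can only create paths, so labels never shrink during the game.\<close>

lemma reach_mono:
  "pos \<subseteq>\<^sub>m pos' \<Longrightarrow> reach t m pos i xs \<subseteq> reach t m pos' i xs"
proof (induction i arbitrary: xs rule: induct_nat_012)
  case 1
  then show ?case
    using tpath_extend by (auto simp del: tpath.simps)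
next
  case (ge2 i)
  have "q_le (down_elem (reach t m pos (Suc i) ys)) (down_elem (reach t m pos' (Suc i) ys))" for ys
    using ge2 by (simp add: q_le_down_elem finite_reach)
  then show ?case
    by (auto simp del: Q.simps intro: q_le_trans)
qed simp

text \<open>Labels of earlier vertices stay frozen while Builder presents edges containing a later
  vertex.\<close>

lemma reach_local:
  "\<forall>e\<subseteq>{..v}. pos e = pos' e \<Longrightarrow> xs \<noteq> [] \<Longrightarrow> set xs \<subseteq> {..v} \<Longrightarrow>
     reach t m pos i xs = reach t m pos' i xs"
proof (induction i arbitrary: xs rule: induct_nat_012)
  case 1
  then show ?case
    using tpath_local[of v pos pos' xs] by (auto simp del: tpath.simps)
next
  case (ge2 i)
  have "reach t m pos (Suc i) (u # xs) = reach t m pos' (Suc i) (u # xs)" if "u < hd xs" for u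
  proof (rule ge2.IH(2)[OF ge2.prems(1)])
    have "hd xs \<le> v"
      using ge2.prems(2,3) hd_in_set by blast
    then show "set (u # xs) \<subseteq> {..v}"
      using that ge2.prems(3) by auto
  qed simp
  then show ?case
    by (auto simp del: Q.simps)
qed simp

section \<open>Edges that force a label to grow\<close>

text \<open>The edge \<open>ys\<close> of colour \<open>c\<close> prolongs a longest path of that
  colour ending in \<open>butlast ys\<close> to a longer one ending in \<open>tl ys\<close>. Without
  a monochromatic copy the new length is below \<open>m\<close>, so it is recorded in the
  label.\<close>

lemma reach_1_not_subset:
  assumes "pos (set ys) = Some c" "c < t" "length ys = k" "k \<ge> 2" "m \<ge> 1"
    "sorted_wrt (<) ys" "set ys \<subseteq> {1..N}"
    "\<not> mono_copy (tight_path k (k + m - 1)) t N pos"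
  shows "\<not> reach t m pos 1 (tl ys) \<subseteq> reach t m pos 1 (butlast ys)"
proof -
  \<comment> \<open>\<open>remdups_adj.cases\<close> separates lists of length 0, 1 and at least
    2.\<close>
  obtain u w ys' where ys: "ys = u # w # ys'"
    using assms(3,4) by (cases ys rule: remdups_adj.cases) auto
  have no_path: "\<not> tpath pos c m xs" if "sorted_wrt (<) xs" "set xs \<subseteq> {1..N}" "length xs = k - 1" for xs
    using mono_copy_of_tpath[of pos c m xs t k N] assms that by blast
  have init: "sorted_wrt (<) (butlast ys)" "set (butlast ys) \<subseteq> {1..N}" "length (butlast ys) = k - 1"
  proof -
    show "sorted_wrt (<) (butlast ys)"
      using assms(6) unfolding butlast_conv_take by (rule sorted_wrt_take)
    show "set (butlast ys) \<subseteq> {1..N}"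
      using assms(7) by (meson in_set_butlastD subset_iff)
    show "length (butlast ys) = k - 1"
      using assms(3) by simp
  qed
  \<comment> \<open>A longest path ending in \<open>butlast ys\<close> has \<open>n - 1\<close>
    edges; \<open>n\<close> is positive because a path without edges always exists. Since
    \<open>Pt c a\<close> stands for a path with \<open>a + 1\<close> edges, the witness is
    \<open>Pt c (n - 1)\<close>.\<close>
  define n where "n = (LEAST n. \<not> tpath pos c n (butlast ys))"
  have n: "\<not> tpath pos c n (butlast ys)"
    unfolding n_def using no_path[OF init] by (rule LeastI)
  then obtain a where a: "n = Suc a"
    by (cases n) auto
  have "tpath pos c a (butlast ys)"
    using not_less_Least[of a "\<lambda>n. \<not> tpath pos c n (butlast ys)"] a n_def by auto
  then have path: "tpath pos c (Suc a) (tl ys)"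
    using assms(1,6,7) by (auto simp: ys Suc_le_eq)
  have "a < m - 1"
  proof (rule ccontr)
    assume "\<not> a < m - 1"
    then have "tpath pos c m (tl ys)"
      using path by (elim tpath_mono) simp
    moreover have "sorted_wrt (<) (tl ys)" "set (tl ys) \<subseteq> {1..N}" "length (tl ys) = k - 1"
      using assms by (auto simp: ys)
    ultimately show False
      using no_path by blast
  qed
  then have "Pt c a \<in> reach t m pos 1 (tl ys)" "Pt c a \<notin> reach t m pos 1 (butlast ys)"
    using path n a assms(2) by (auto simp del: tpath.simps)
  then show ?thesis
    by blast
qed

text \<open>The label of \<open>ys\<close> itself is the witness: it counts for \<open>tl ys\<close>
  through the prepended vertex \<open>hd ys\<close>, and \<open>not_sub\<close> says that no vertex
  prepended to \<open>butlast ys\<close> dominates it.\<close>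

lemma reach_Suc_not_subset:
  assumes "i \<ge> 1" "length ys \<ge> 2" "sorted_wrt (<) ys" "hd ys > 0"
    and not_sub: "\<And>u. 0 < u \<Longrightarrow> u < hd ys \<Longrightarrow>
      \<not> reach t m pos i ys \<subseteq> reach t m pos i (u # butlast ys)"
  shows "\<not> reach t m pos (Suc i) (tl ys) \<subseteq> reach t m pos (Suc i) (butlast ys)"
proof -
  obtain u w ys' where ys: "ys = u # w # ys'"
    using assms(2) by (cases ys rule: remdups_adj.cases) auto
  obtain i' where i: "i = Suc i'"
    using assms(1) by (cases i) auto
  let ?x = "down_elem (reach t m pos i ys)"
  have "?x \<in> Q t m (Suc i)"
    using assms(1) by (intro down_elem_in_Q down_set_of_reach)
  moreover have "q_le ?x (down_elem (reach t m pos i (hd ys # tl ys)))" "0 < hd ys" "hd ys < hd (tl ys)"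
    using q_le_refl assms(3,4) by (auto simp: ys)
  ultimately have "?x \<in> reach t m pos (Suc i) (tl ys)"
    unfolding i by (simp del: Q.simps) blast
  moreover have "?x \<notin> reach t m pos (Suc i) (butlast ys)"
  proof
    assume "?x \<in> reach t m pos (Suc i) (butlast ys)"
    then obtain v where v: "0 < v" "v < hd (butlast ys)"
        "q_le ?x (down_elem (reach t m pos i (v # butlast ys)))"
      unfolding i by (simp del: Q.simps) blast
    then have "v < hd ys"
      by (simp add: ys)
    then show False
      using v not_sub by (simp add: q_le_down_elem finite_reach)
  qed
  ultimately show ?thesis
    by blast
qed

text \<open>The inclusion-maximal values of \<open>f\<close> are pairwise incomparable, hence form
  an antichain of the next poset, and every value lies below a maximal one. \<open>R\<close> picks
  one preimage for each.\<close>

lemma maximal_representatives: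
  assumes "finite U" "i \<ge> 1"
    and ds: "\<And>u. u \<in> U \<Longrightarrow> down_set_of (Q t m i) (f u)"
  shows "\<exists>R\<subseteq>U. card R \<le> max_antichain t m (Suc i) \<and> (\<forall>u\<in>U. \<exists>r\<in>R. f u \<subseteq> f r)"
proof -
  define Mx where "Mx = {X \<in> f ` U. \<forall>Y\<in>f ` U. X \<subseteq> Y \<longrightarrow> X = Y}"
  have Mx_ds: "down_set_of (Q t m i) X" if "X \<in> Mx" for X
    using that ds by (auto simp: Mx_def)
  have "inj_on down_elem Mx"
    using Mx_ds bij_betw_down_elem[OF assms(2), of t m]
    by (auto simp: bij_betw_def intro: inj_on_subset)
  then have "card Mx = card (down_elem ` Mx)"
    by (simp add: card_image)
  also have "\<dots> \<le> max_antichain t m (Suc i)"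
  proof (rule card_le_max_antichain)
    show "down_elem ` Mx \<subseteq> Q t m (Suc i)"
      using Mx_ds down_elem_in_Q[OF assms(2)] by blast
    have "X = Y" if "X \<in> Mx" "Y \<in> Mx" "q_le (down_elem X) (down_elem Y)" for X Y
    proof -
      have "X \<subseteq> Y"
        using that Mx_ds[THEN down_set_of_finite] by (simp add: q_le_down_elem)
      then show ?thesis
        using that(1,2) by (auto simp: Mx_def)
    qed
    then show "antichain (down_elem ` Mx)"
      unfolding antichain_def by blast
  qed
  finally have "card Mx \<le> max_antichain t m (Suc i)" .
  moreover have "Mx \<subseteq> f ` U"
    by (auto simp: Mx_def)
  then obtain R where R: "R \<subseteq> U" "inj_on f R" "f ` R = Mx"
    unfolding subset_image_inj by metis
  moreover have "\<exists>r\<in>R. f u \<subseteq> f r" if u: "u \<in> U" for u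
  proof -
    obtain X where "X \<in> f ` U" "f u \<subseteq> X" "\<forall>Y\<in>f ` U. X \<subseteq> Y \<longrightarrow> X = Y"
      using finite_has_maximal2[of "f ` U" "f u"] assms(1) u by blast
    then have "X \<in> f ` R"
      by (simp add: R(3) Mx_def)
    then show ?thesis
      using \<open>f u \<subseteq> X\<close> by blast
  qed
  ultimately show ?thesis
    by (metis card_image)
qed

text \<open>
  Only lists \<open>u # butlast ys\<close> with maximal label have to be treated, so the number of edges
  grows by a factor \<open>a\<^bsub>i+1\<^esub>\<close> with each level.
\<close>

lemma forcing_edges:
  assumes "i \<ge> 1" "length ys + i = k + 1" "length ys \<ge> 2" "m \<ge> 1"
    "sorted_wrt (<) ys" "set ys \<subseteq> {1..N}"
  shows "\<exists>F. finite F \<and> card F \<le> (\<Prod>l = 2..i. max_antichain t m l) \<and>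
    (\<forall>e\<in>F. e \<subseteq> {1..last ys} \<and> last ys \<in> e \<and> card e = k) \<and>
    (\<forall>pos'. F \<subseteq> dom pos' \<longrightarrow> ran pos' \<subseteq> {..<t} \<longrightarrow> (\<forall>e\<subseteq>{..<last ys}. pos e = pos' e) \<longrightarrow>
       \<not> mono_copy (tight_path k (k + m - 1)) t N pos' \<longrightarrow>
       \<not> reach t m pos' i (tl ys) \<subseteq> reach t m pos' i (butlast ys))"
  using assms
proof (induction i arbitrary: ys rule: nat_induct_at_least)
  case base
  have ne: "ys \<noteq> []"
    using base.prems by auto
  have "set ys \<subseteq> {1..last ys}"
  proof
    fix x assume x: "x \<in> set ys"
    have "ys = butlast ys @ [last ys]"
      using ne by simp
    then have "x \<le> last ys"
      using x base.prems(4) by (metis Un_iff empty_iff empty_set insert_iff list.simps(15) order_le_less set_append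
          sorted_wrt_append)
    then show "x \<in> {1..last ys}"
      using x base.prems(5) by auto
  qed
  moreover have "card (set ys) = k"
    using base.prems by (simp add: distinct_card strict_sorted_iff)
  moreover have "\<not> reach t m pos' 1 (tl ys) \<subseteq> reach t m pos' 1 (butlast ys)"
    if pos': "{set ys} \<subseteq> dom pos'" "ran pos' \<subseteq> {..<t}"
      "\<not> mono_copy (tight_path k (k + m - 1)) t N pos'" for pos'
  proof -
    obtain c where c: "pos' (set ys) = Some c"
      using pos'(1) by auto
    then have "c < t"
      using pos'(2) by (auto simp: ran_def)
    with c show ?thesis
      using pos'(3) base.prems by (intro reach_1_not_subset) auto
  qed
  \<comment> \<open>The single edge \<open>ys\<close> suffices; the product over
    \<open>{2..1}\<close> is empty, so the bound is 1.\<close>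
  ultimately show ?case
    using ne by (intro exI[of _ "{set ys}"]) simp
next
  case (Suc i)
  have ne: "ys \<noteq> []" "butlast ys \<noteq> []"
    using Suc.prems(2) by (cases ys; cases "tl ys"; auto)+
  have split: "ys = butlast ys @ [last ys]"
    using ne by simp
  have less_last: "x < last ys" if "x \<in> set (butlast ys)" for x
    using that split Suc.prems(4) by (metis list.set_intros(1) sorted_wrt_append)
  have hd_eq: "hd (butlast ys) = hd ys"
    using ne split by (metis hd_append2)
  define f where "f u = reach t m pos i (u # butlast ys)" for u
  obtain R where R: "R \<subseteq> {0<..<hd ys}" "card R \<le> max_antichain t m (Suc i)"
      "\<forall>u\<in>{0<..<hd ys}. \<exists>r\<in>R. f u \<subseteq> f r"
    using maximal_representatives[of "{0<..<hd ys}" i t m f] Suc.hyps down_set_of_reach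
    unfolding f_def by blast
  have finR: "finite R"
    using R(1) by (rule finite_subset) simp
  \<comment> \<open>This is the induction hypothesis for the list \<open>r # ys\<close>, whose tail
    is \<open>ys\<close> and whose \<open>butlast\<close> is \<open>r # butlast ys\<close>.\<close>
  define good where "good F r \<longleftrightarrow> finite F \<and> card F \<le> (\<Prod>l = 2..i. max_antichain t m l) \<and>
      (\<forall>e\<in>F. e \<subseteq> {1..last ys} \<and> last ys \<in> e \<and> card e = k) \<and>
      (\<forall>pos'. F \<subseteq> dom pos' \<longrightarrow> ran pos' \<subseteq> {..<t} \<longrightarrow> (\<forall>e\<subseteq>{..<last ys}. pos e = pos' e) \<longrightarrow>
        \<not> mono_copy (tight_path k (k + m - 1)) t N pos' \<longrightarrow>
        \<not> reach t m pos' i ys \<subseteq> reach t m pos' i (r # butlast ys))" for F r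
  have "\<exists>F. good F r" if "r \<in> R" for r
  proof -
    have r: "0 < r" "r < hd ys"
      using that R(1) by auto
    have "sorted_wrt (<) (r # ys)"
      using r Suc.prems(4) ne by (cases ys) auto
    moreover have "set (r # ys) \<subseteq> {1..N}"
      using r Suc.prems(5) ne by (cases ys) auto
    ultimately show ?thesis
      using Suc.IH[of "r # ys"] Suc.prems(1-3) ne unfolding good_def by simp
  qed
  then obtain F where F: "\<And>r. r \<in> R \<Longrightarrow> good (F r) r"
    by metis
  have "card (\<Union>r\<in>R. F r) \<le> (\<Sum>r\<in>R. card (F r))"
    using finR by (rule card_UN_le)
  also have "\<dots> \<le> card R * (\<Prod>l = 2..i. max_antichain t m l)"
    using F by (intro sum_bounded_above[where 'a = nat, simplified]) (simp add: good_def)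
  also have "\<dots> \<le> max_antichain t m (Suc i) * (\<Prod>l = 2..i. max_antichain t m l)"
    using R(2) by simp
  also have "\<dots> = (\<Prod>l = 2..Suc i. max_antichain t m l)"
    using Suc.hyps by (simp add: prod.nat_ivl_Suc')
  finally have card_F: "card (\<Union>r\<in>R. F r) \<le> (\<Prod>l = 2..Suc i. max_antichain t m l)" .
  have forced: "\<not> reach t m pos' (Suc i) (tl ys) \<subseteq> reach t m pos' (Suc i) (butlast ys)"
    if pos': "(\<Union>r\<in>R. F r) \<subseteq> dom pos'" "ran pos' \<subseteq> {..<t}" "\<forall>e\<subseteq>{..<last ys}. pos e = pos' e"
      "\<not> mono_copy (tight_path k (k + m - 1)) t N pos'" for pos'
  proof (rule reach_Suc_not_subset)
    fix u assume u: "0 < u" "u < hd ys"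
    then have "u \<in> {0<..<hd ys}"
      by simp
    then obtain r where r: "r \<in> R" "f u \<subseteq> f r"
      using R(3) by blast
    \<comment> \<open>The lists \<open>w # butlast ys\<close> lie strictly below
      \<open>last ys\<close>, where both positions agree. So the representatives chosen before
      Painter answers are still valid afterwards.\<close>
    have same: "f w = reach t m pos' i (w # butlast ys)" if "w < hd ys" for w
      unfolding f_def
    proof (rule reach_local[of "last ys - 1"])
      have "hd ys < last ys"
        using less_last hd_in_set[OF ne(2)] hd_eq by simp
      then have "{..last ys - 1} = {..<last ys}"
        by auto
      then show "\<forall>e\<subseteq>{..last ys - 1}. pos e = pos' e" "set (w # butlast ys) \<subseteq> {..last ys - 1}"
        using pos'(3) less_last that \<open>hd ys < last ys\<close> by auto
    qed simp
    have "\<not> reach t m pos' i ys \<subseteq> reach t m pos' i (r # butlast ys)"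
    proof -
      have "F r \<subseteq> dom pos'"
        using pos'(1) r(1) by blast
      then show ?thesis
        using F[OF r(1)] pos'(2-4) unfolding good_def by blast
    qed
    moreover have "r < hd ys"
      using r(1) R(1) by auto
    ultimately show "\<not> reach t m pos' i ys \<subseteq> reach t m pos' i (u # butlast ys)"
      using same[of r] same[OF u(2)] r(2) by auto
  next
    show "hd ys > 0"
      using Suc.prems(5) hd_in_set[OF ne(1)] by auto
  qed (use Suc in auto)
  show ?case
    using finR F card_F forced unfolding good_def by (intro exI[of _ "\<Union>r\<in>R. F r"]) auto
qed

section \<open>Builder's strategy\<close>

lemma builder_wins_mono_copy: "mono_copy G t N pos \<Longrightarrow> builder_wins k G t N s pos"
  by (cases s) auto

lemma builder_wins_mono:
  "builder_wins k G t N s pos \<Longrightarrow> s \<le> s' \<Longrightarrow> builder_wins k G t N s' pos"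
proof (induction s arbitrary: pos s')
  case 0
  then show ?case
    by (simp add: builder_wins_mono_copy)
next
  case (Suc s)
  then obtain s'' where s'': "s' = Suc s''" "s \<le> s''"
    by (cases s') auto
  show ?case
    using Suc.prems(1) Suc.IH[OF _ s''(2)] unfolding s''(1) builder_wins.simps by blast
qed

text \<open>Builder presents all of \<open>F\<close> without reacting to the answers; the last
  assumption therefore covers every colouring of \<open>F\<close> that Painter may produce.\<close>

lemma builder_wins_present:
  assumes "finite F" "\<forall>e\<in>F. e \<subseteq> {1..N} \<and> card e = k" "F \<inter> dom pos = {}" "ran pos \<subseteq> {..<t}"
    and "\<And>pos'. pos \<subseteq>\<^sub>m pos' \<Longrightarrow> dom pos' = dom pos \<union> F \<Longrightarrow> ran pos' \<subseteq> {..<t} \<Longrightarrow>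
      builder_wins k G t N s pos'"
  shows "builder_wins k G t N (card F + s) pos"
  using assms
proof (induction F arbitrary: pos rule: finite_induct)
  case (insert e F)
  have "builder_wins k G t N (card F + s) (pos(e \<mapsto> col))" if "col < t" for col
  proof (rule insert.IH)
    show "ran (pos(e \<mapsto> col)) \<subseteq> {..<t}"
      using insert.prems(3) that by (auto simp: ran_def)
    show "F \<inter> dom (pos(e \<mapsto> col)) = {}"
      using insert.prems(2) insert.hyps by auto
    fix pos' assume pos': "pos(e \<mapsto> col) \<subseteq>\<^sub>m pos'" "dom pos' = dom (pos(e \<mapsto> col)) \<union> F" "ran pos' \<subseteq> {..<t}"
    have "pos \<subseteq>\<^sub>m pos(e \<mapsto> col)"
      using insert.prems(2) by (auto simp: map_le_def)
    then have "pos \<subseteq>\<^sub>m pos'"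
      using pos'(1) map_le_trans by blast
    then show "builder_wins k G t N s pos'"
      using pos' insert.prems(4) by auto
  qed (use insert.prems in auto)
  moreover have "e \<subseteq> {1..N}" "card e = k" "e \<notin> dom pos"
    using insert.prems by auto
  ultimately show ?case
    using insert.hyps by (auto simp del: fun_upd_apply)
qed simp

lemma Q_nonempty:
  assumes "t \<ge> 1" "m \<ge> 2" "j \<ge> 1"
  shows "Q t m j \<noteq> {}"
proof (cases "j = 1")
  case True
  have "Pt 0 0 \<in> Q t m 1"
    using assms by auto
  then show ?thesis
    using True by blast
next
  case False
  have "down_set_of (Q t m (j - 1)) {}"
    by (simp add: down_set_of_def)
  then have "down_elem {} \<in> Q t m (Suc (j - 1))"
    using False assms by (intro down_elem_in_Q) auto
  then show ?thesis
    using assms by auto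
qed

lemma max_antichain_pos:
  assumes "t \<ge> 1" "m \<ge> 2" "j \<ge> 1"
  shows "max_antichain t m j \<ge> 1"
proof -
  obtain x where "x \<in> Q t m j"
    using Q_nonempty[OF assms] by blast
  then have "card {x} \<le> max_antichain t m j"
    by (intro card_le_max_antichain) (auto simp: antichain_def)
  then show ?thesis
    by simp
qed

text \<open>The invariant is that the vertices before \<open>v\<close> have pairwise distinct labels
  and no edge reaches beyond \<open>v\<close>. The round bound allots up to \<open>q\<close> blocks
  of at most \<open>P\<close> edges to each vertex; the extra block pays for a final one after which
  the label of \<open>v\<close> has no room left to grow.\<close>

lemma builder_wins_from_position:
  fixes k m t N :: nat
  defines "K \<equiv> card (Q t m k)" and "q \<equiv> card (Q t m (k - 1))"
    and "P \<equiv> (\<Prod>l = 2..k - 1. max_antichain t m l)"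
  assumes "k \<ge> 2" "m \<ge> 1" "N \<ge> K + 1"
    and "1 \<le> v" "v \<le> K + 1" "dom pos \<subseteq> Pow {1..v}" "ran pos \<subseteq> {..<t}"
      "inj_on (\<lambda>u. reach t m pos (k - 1) [u]) {1..<v}"
  shows "builder_wins k (tight_path k (k + m - 1)) t N
    (((K + 1 - v) * q + (q - card (reach t m pos (k - 1) [v])) + 1) * P) pos"
  using assms(7-)
\<comment> \<open>The weight \<open>q + 1\<close>, in contrast to \<open>q\<close> in the round
  bound, makes the measure drop strictly also on passing to the next vertex, which costs no
  round.\<close>
proof (induction "(K + 1 - v) * (q + 1) + (q - card (reach t m pos (k - 1) [v]))"
    arbitrary: v pos rule: less_induct)
  case less
  let ?G = "tight_path k (k + m - 1)"
  let ?lab = "\<lambda>pos u. reach t m pos (k - 1) [u]"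
  have k1: "k - 1 \<ge> 1" "Suc (k - 1) = k"
    using \<open>k \<ge> 2\<close> by auto
  have card_lab: "card (?lab pos u) \<le> q" for pos u
    unfolding q_def using down_set_of_reach by (intro card_mono finite_Q) (auto simp: down_set_of_def)
  have vN: "v \<le> N"
    using less.prems \<open>N \<ge> K + 1\<close> by simp
  consider "mono_copy ?G t N pos" | "?lab pos v \<notin> ?lab pos ` {1..<v}"
    | u where "\<not> mono_copy ?G t N pos" "1 \<le> u" "u < v" "?lab pos v = ?lab pos u"
    by (metis (no_types, lifting) atLeastLessThan_iff imageE)
  then show ?case
  proof cases
    case 1
    then show ?thesis
      by (rule builder_wins_mono_copy)
  next
    \<comment> \<open>The label of \<open>v\<close> is new. There are only \<open>K\<close> possible
      labels, so \<open>v <= K\<close> and Builder may move on to the next vertex.\<close>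
    case 2
    have "{1..<Suc v} = insert v {1..<v}"
      using less.prems(1) by auto
    moreover have "inj_on (?lab pos) (insert v {1..<v})"
      using 2 less.prems(5) by (simp add: inj_on_insert)
    ultimately have inj: "inj_on (?lab pos) {1..<Suc v}"
      by simp
    have "?lab pos ` {1..<Suc v} \<subseteq> {S. down_set_of (Q t m (k - 1)) S}"
      using down_set_of_reach by blast
    moreover have "finite {S. down_set_of (Q t m (k - 1)) S}"
      by (rule finite_subset[of _ "Pow (Q t m (k - 1))"]) (auto simp: down_set_of_def finite_Q)
    ultimately have "card {1..<Suc v} \<le> card {S. down_set_of (Q t m (k - 1)) S}"
      using inj by (intro card_inj_on_le)
    also have "\<dots> = K"
      using bij_betw_same_card[OF bij_betw_down_elem[OF k1(1)]] k1(2) by (simp add: K_def)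
    finally have "v \<le> K"
      by simp
    then have eq: "K + 1 - v = Suc (K - v)" "K + 1 - Suc v = K - v"
      by auto
    have "builder_wins k ?G t N
        (((K + 1 - Suc v) * q + (q - card (?lab pos (Suc v))) + 1) * P) pos"
    proof (rule less.hyps)
      show "(K + 1 - Suc v) * (q + 1) + (q - card (?lab pos (Suc v)))
          < (K + 1 - v) * (q + 1) + (q - card (?lab pos v))"
        unfolding eq by simp
      show "dom pos \<subseteq> Pow {1..Suc v}"
        using less.prems(3) by fastforce
    qed (use inj less.prems \<open>v \<le> K\<close> in auto)
    then show ?thesis
      by (rule builder_wins_mono) (unfold eq, intro mult_right_mono, auto)
  next
    case 3
    \<comment> \<open>For the list \<open>[u, v]\<close> at level \<open>k - 1\<close>, the tail is
      \<open>[v]\<close> and the \<open>butlast\<close> is \<open>[u]\<close>, so the forced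
      non-inclusion compares the labels of the two vertices.\<close>
    obtain F where F: "finite F" "card F \<le> P" "\<forall>e\<in>F. e \<subseteq> {1..v} \<and> v \<in> e \<and> card e = k"
      "\<forall>pos'. F \<subseteq> dom pos' \<longrightarrow> ran pos' \<subseteq> {..<t} \<longrightarrow> (\<forall>e\<subseteq>{..<v}. pos e = pos' e) \<longrightarrow>
        \<not> mono_copy ?G t N pos' \<longrightarrow> \<not> ?lab pos' v \<subseteq> ?lab pos' u"
      using forcing_edges[OF k1(1), of "[u, v]" k m N t pos] 3 vN \<open>k \<ge> 2\<close> \<open>m \<ge> 1\<close>
      unfolding P_def by auto
    define s where "s = ((K + 1 - v) * q + (q - card (?lab pos v))) * P"
    \<comment> \<open>Edges of \<open>F\<close> that are already coloured may not be presented
      again.\<close>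
    have "builder_wins k ?G t N (card (F - dom pos) + s) pos"
    proof (rule builder_wins_present)
      show "\<forall>e\<in>F - dom pos. e \<subseteq> {1..N} \<and> card e = k"
        using F(3) vN by fastforce
      fix pos' assume pos': "pos \<subseteq>\<^sub>m pos'" "dom pos' = dom pos \<union> (F - dom pos)" "ran pos' \<subseteq> {..<t}"
      have agree: "pos e = pos' e" if e: "e \<subseteq> {..<v}" for e
      proof (cases "e \<in> dom pos")
        case True
        then show ?thesis
          using pos'(1) by (auto simp: map_le_def)
      next
        case False
        moreover have "e \<notin> F"
          using F(3) e by auto
        ultimately show ?thesis
          using pos'(2) by (metis DiffD1 UnE domIff)
      qed
      have same: "?lab pos w = ?lab pos' w" if "w < v" for w
      proof (rule reach_local[of "v - 1"])
        have "{..v - 1} = {..<v}"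
          using that by auto
        then show "\<forall>e\<subseteq>{..v - 1}. pos e = pos' e"
          using agree by simp
      qed (use that in auto)
      show "builder_wins k ?G t N s pos'"
      proof (cases "mono_copy ?G t N pos'")
        case True
        then show ?thesis
          by (rule builder_wins_mono_copy)
      next
        case False
        have "F \<subseteq> dom pos'"
          using pos'(2) by auto
        then have "\<not> ?lab pos' v \<subseteq> ?lab pos' u"
          using F(4) pos'(3) False agree by blast
        \<comment> \<open>The label of \<open>u\<close> is unchanged and was equal to the old label
          of \<open>v\<close>, so the new label of \<open>v\<close> escapes its own old
          value.\<close>
        then have "\<not> ?lab pos' v \<subseteq> ?lab pos v"
          using same[OF 3(3)] 3(4) by simp
        then have "?lab pos v \<subset> ?lab pos' v"
          using reach_mono[OF pos'(1)] by blast
        then have grows: "card (?lab pos v) < card (?lab pos' v)"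
          by (intro psubset_card_mono finite_reach)
        then have less_q: "q - card (?lab pos' v) < q - card (?lab pos v)"
          using card_lab[of pos' v] by simp
        have "builder_wins k ?G t N (((K + 1 - v) * q + (q - card (?lab pos' v)) + 1) * P) pos'"
        proof (rule less.hyps)
          show "(K + 1 - v) * (q + 1) + (q - card (?lab pos' v))
              < (K + 1 - v) * (q + 1) + (q - card (?lab pos v))"
            using less_q by (rule add_strict_left_mono)
          show "dom pos' \<subseteq> Pow {1..v}"
            using pos'(2) less.prems(3) F(3) by auto
          have "inj_on (?lab pos') {1..<v} = inj_on (?lab pos) {1..<v}"
            using same by (intro inj_on_cong) auto
          then show "inj_on (?lab pos') {1..<v}"
            using less.prems(5) by simp
        qed (use less.prems pos' in auto)
        moreover have "(K + 1 - v) * q + (q - card (?lab pos' v)) + 1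
            \<le> (K + 1 - v) * q + (q - card (?lab pos v))"
          using less_q by linarith
        then have "((K + 1 - v) * q + (q - card (?lab pos' v)) + 1) * P \<le> s"
          unfolding s_def by (rule mult_right_mono) simp
        ultimately show ?thesis
          by (rule builder_wins_mono)
      qed
    qed (use F(1) less.prems in auto)
    moreover have "card (F - dom pos) \<le> P"
      using F(1,2) card_mono[of F "F - dom pos"] by auto
    ultimately show ?thesis
      by (elim builder_wins_mono) (simp add: s_def algebra_simps)
  qed
qed

text \<open>Starting at vertex 1 with no edges, \<open>(K * q + q + 1) * P\<close> rounds suffice on
  any supply of at least \<open>K + 1\<close> vertices. As \<open>K >= 2\<close> and
  \<open>q >= 1\<close>, the bracket is at most \<open>2 * (K * q)\<close>, and the factor 2 is
  covered by the largest antichain of \<open>Q t m 1\<close>.\<close>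

lemma online_size_ramsey_tight_path_le:
  assumes "k \<ge> 2" "m \<ge> 2" "t \<ge> 2"
  shows "online_size_ramsey k t (tight_path k (k + m - 1))
    \<le> enat (card (Q t m k) * card (Q t m (k - 1)) * (\<Prod>i = 1..k - 1. max_antichain t m i))"
proof -
  define K where "K = card (Q t m k)"
  define q where "q = card (Q t m (k - 1))"
  define P where "P = (\<Prod>l = 2..k - 1. max_antichain t m l)"
  have k: "Suc (k - 1) = k"
    using assms(1) by simp
  have "q \<ge> 1"
    using Q_nonempty[of t m "k - 1"] finite_Q[of t m "k - 1"] assms
    by (simp add: q_def Suc_le_eq card_gt_0_iff)
  have "(2::nat) ^ 1 \<le> 2 ^ max_antichain t m (k - 1)"
    using max_antichain_pos[of t m "k - 1"] assms by (intro power_increasing) auto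
  also have "\<dots> \<le> K"
    using two_power_max_antichain_le[of "k - 1" t m] k assms by (simp add: K_def)
  finally have "K \<ge> 2"
    by simp
  have "q * 2 \<le> q * K"
    using \<open>K \<ge> 2\<close> by simp
  then have "K * q + q + 1 \<le> 2 * (K * q)"
    using \<open>q \<ge> 1\<close> unfolding mult.commute[of K q] by linarith
  also have "\<dots> \<le> max_antichain t m 1 * (K * q)"
    using max_antichain_1_ge[of t m] assms by (intro mult_right_mono) auto
  finally have "(K * q + q + 1) * P \<le> max_antichain t m 1 * (K * q) * P"
    by (rule mult_right_mono) simp
  also have "\<dots> = K * q * (max_antichain t m 1 * P)"
    by (simp add: ac_simps)
  also have "max_antichain t m 1 * P = (\<Prod>i = 1..k - 1. max_antichain t m i)"
    using assms(1) prod.atLeast_Suc_atMost[of 1 "k - 1" "max_antichain t m"]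
    by (simp add: P_def numeral_2_eq_2)
  finally have rounds: "(K * q + q + 1) * P \<le> K * q * (\<Prod>i = 1..k - 1. max_antichain t m i)" .
  have "builder_wins k (tight_path k (k + m - 1)) t N
      (K * q * (\<Prod>i = 1..k - 1. max_antichain t m i)) Map.empty" if "N \<ge> K + 1" for N
  proof -
    have "builder_wins k (tight_path k (k + m - 1)) t N
      (((K + 1 - 1) * q + (q - card (reach t m Map.empty (k - 1) [1])) + 1) * P) Map.empty"
      unfolding K_def q_def P_def
      using that assms by (intro builder_wins_from_position) (auto simp: K_def)
    moreover have "((K + 1 - 1) * q + (q - card (reach t m Map.empty (k - 1) [1])) + 1) * P
        \<le> (K * q + q + 1) * P"
      by (intro mult_right_mono) auto
    ultimately show ?thesis
      using rounds builder_wins_mono le_trans by blast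
  qed
  then have "\<forall>\<^sub>F N in sequentially. builder_wins k (tight_path k (k + m - 1)) t N
      (K * q * (\<Prod>i = 1..k - 1. max_antichain t m i)) Map.empty"
    by (rule eventually_sequentiallyI)
  then show ?thesis
    unfolding online_size_ramsey_def K_def q_def by (intro INF_lower) simp
qed

section \<open>Estimates\<close>

text \<open>A large product does not make \<open>t\<close> large, hence two cases: for
  \<open>t >= T\<close> already \<open>2 ^ (t - 1)\<close> beats the left side, and for
  \<open>t < T\<close> the factor \<open>m\<close> is so large that its first power
  suffices.\<close>

lemma powr_le_power_of_product_ge:
  fixes C :: real
  assumes "C > 0"
  shows "\<exists>M::nat. \<forall>t m :: nat. t \<ge> 2 \<longrightarrow> m \<ge> 2 \<longrightarrow> t * m \<ge> M \<longrightarrow> real t powr C \<le> real m ^ (t - 1)"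
proof -
  have "\<forall>\<^sub>F t::nat in sequentially. real t powr C \<le> 2 powr (real t - 1)"
    using assms by real_asymp
  then obtain T where T: "\<And>t. t \<ge> T \<Longrightarrow> real t powr C \<le> 2 powr (real t - 1)"
    unfolding eventually_sequentially by blast
  define D where "D = nat \<lceil>real T powr C\<rceil>"
  have "real t powr C \<le> real m ^ (t - 1)" if "t \<ge> 2" "m \<ge> 2" "t * m \<ge> T * D" for t m
  proof (cases "t \<ge> T")
    case True
    have "real t powr C \<le> 2 powr (real t - 1)"
      by (rule T[OF True])
    also have "\<dots> = 2 ^ (t - 1)"
      using that(1) by (simp add: powr_realpow[symmetric] of_nat_diff)
    also have "\<dots> \<le> real m ^ (t - 1)"
      using that(2) by (intro power_mono) auto
    finally show ?thesis .
  next
    case False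
    have "D \<le> m"
    proof (rule ccontr)
      assume "\<not> D \<le> m"
      then have "t * m < T * D"
        using False that by (intro mult_strict_mono) auto
      then show False
        using that(3) by simp
    qed
    then have "real T powr C \<le> real m"
      unfolding D_def by linarith
    moreover have "real t powr C \<le> real T powr C"
      using False assms by (intro powr_mono2) auto
    moreover have "real m \<le> real m ^ (t - 1)"
      using that by (intro self_le_power) auto
    ultimately show ?thesis
      by linarith
  qed
  then show ?thesis
    by blast
qed

lemma power_powr:
  fixes x :: real
  assumes "x > 0"
  shows "(x ^ n) powr a = x powr (real n * a)"
  by (simp add: powr_realpow[OF assms, symmetric] powr_powr)

lemma max_antichain_le_log_card:
  assumes "j \<ge> 1"
  shows "real (max_antichain t m j) \<le> log 2 (real (card (Q t m (Suc j))))"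
proof -
  have "(2::real) ^ max_antichain t m j \<le> real (card (Q t m (Suc j)))"
    using two_power_max_antichain_le[OF assms, of t m] by (metis of_nat_le_iff of_nat_numeral of_nat_power)
  then have "log 2 (2 ^ max_antichain t m j) \<le> log 2 (real (card (Q t m (Suc j))))"
    by (intro log_mono) auto
  then show ?thesis
    by simp
qed

lemma of_nat_card_Q_Suc_le:
  assumes "j \<ge> 1"
  shows "real (card (Q t m (Suc j))) \<le> (real (card (Q t m j)) + 1) * real (max_antichain t m (Suc j))"
proof -
  have "real (card (Q t m (Suc j))) \<le> real ((card (Q t m j) + 1) * max_antichain t m (Suc j))"
    unfolding of_nat_le_iff by (rule card_Q_Suc_le[OF assms])
  then show ?thesis
    by (simp add: algebra_simps)
qed

lemma of_nat_power_le_card_Q_2: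
  assumes "m \<ge> 2"
  shows "real m ^ t \<le> real (card (Q t m 2))"
proof -
  have "real (m ^ t) \<le> real (card (Q t m 2))"
    unfolding of_nat_le_iff using assms by (intro power_le_card_Q_2) simp
  then show ?thesis
    by simp
qed

lemma card_Q_2_le_max_antichain:
  assumes "t \<ge> 2" "m \<ge> 2"
  shows "real (card (Q t m 2)) \<le> real t * real m * real (max_antichain t m 2)"
proof -
  have "card (Q t m 2) \<le> (t * (m - 1) + 1) * max_antichain t m 2"
    using card_Q_Suc_le[of 1 t m] card_Q_1[of t m] by (simp add: numeral_2_eq_2 del: Q.simps)
  also have "t * (m - 1) + 1 \<le> t * m"
    using assms by (cases m) auto
  finally have "card (Q t m 2) \<le> t * m * max_antichain t m 2"
    by simp
  then show ?thesis
    by (metis of_nat_le_iff of_nat_mult)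
qed

text \<open>With \<open>L\<close> the logarithm of \<open>card (Q t m 3)\<close>, the three factors
  besides \<open>card (Q t m 3)\<close> are at most \<open>t * m * L\<close>, \<open>L\<close> and
  \<open>t\<close>. The surplus \<open>t ^ 2 * m\<close> is split as \<open>m / t\<close> times
  \<open>t ^ 3\<close>, which fit into the powers of \<open>L\<close> with exponents
  \<open>1 / (t - 1)\<close> and \<epsilon>.\<close>

lemma bound_for_k_3:
  assumes "t \<ge> 2" "m \<ge> 2" "\<epsilon> > 0" and large: "real t powr (3 / \<epsilon> + 1) \<le> real m ^ (t - 1)"
  shows "real (card (Q t m 3) * card (Q t m 2) * max_antichain t m 2 * max_antichain t m 1)
    \<le> real (card (Q t m 3)) * (log 2 (real (card (Q t m 3)))) powr (2 + 1 / (real t - 1) + \<epsilon>)"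
proof -
  define L where "L = log 2 (real (card (Q t m 3)))"
  \<comment> \<open>Dividing \<open>m ^ t <= ?c <= t * m * ?a\<close> by \<open>t * m\<close> gives
    \<open>B <= ?a\<close>, a lower bound for \<open>L\<close>; the assumption \<open>large\<close>
    says that \<open>B\<close> is at least \<open>t powr (3 / \<epsilon>)\<close>.\<close>
  define B where "B = real m ^ (t - 1) / real t"
  let ?c = "real (card (Q t m 2))" and ?a = "real (max_antichain t m 2)"
  have a_le: "?a \<le> L"
    using max_antichain_le_log_card[of 2 t m] by (simp add: L_def numeral_3_eq_3 numeral_2_eq_2)
  have c_le: "?c \<le> real t * real m * ?a"
    using assms by (intro card_Q_2_le_max_antichain)
  have pos: "real t > 0" "real m > 0"
    using assms by auto
  have "real m ^ t \<le> ?c"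
    using assms by (intro of_nat_power_le_card_Q_2)
  moreover have "real m ^ t = real m * real m ^ (t - 1)"
    using assms by (cases t) auto
  ultimately have "real m * real m ^ (t - 1) \<le> real m * (real t * ?a)"
    using c_le by (simp add: mult_ac)
  then have "B \<le> ?a"
    using pos by (simp add: B_def field_simps)
  then have "B \<le> L"
    using a_le by simp
  have B_ge: "real t powr (3 / \<epsilon>) \<le> B"
    using large pos by (simp add: B_def powr_add field_simps)
  moreover have "real t powr (3 / \<epsilon>) \<ge> 1"
    using assms by (intro ge_one_powr_ge_zero) auto
  ultimately have "B \<ge> 1"
    by simp
  have "real t ^ 3 = (real t powr (3 / \<epsilon>)) powr \<epsilon>"
    using assms pos by (simp add: powr_powr powr_numeral)
  also have "\<dots> \<le> L powr \<epsilon>"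
    using B_ge \<open>B \<le> L\<close> assms by (intro powr_mono2) auto
  finally have L1: "real t ^ 3 \<le> L powr \<epsilon>" .
  have "real m / real t \<le> B powr (1 / (real t - 1))"
  proof -
    \<comment> \<open>The exponent is at most 1 because \<open>t >= 2\<close>.\<close>
    have "real t powr (1 / (real t - 1)) \<le> real t powr 1"
      using assms by (intro powr_mono) (auto simp: field_simps)
    then have "real m / real t \<le> real m / real t powr (1 / (real t - 1))"
      using pos by (intro divide_left_mono) auto
    also have "\<dots> = (real m ^ (t - 1)) powr (1 / (real t - 1)) / real t powr (1 / (real t - 1))"
      using assms by (simp add: power_powr of_nat_diff)
    also have "\<dots> = B powr (1 / (real t - 1))"
      by (simp add: B_def powr_divide)
    finally show ?thesis .
  qed
  also have "\<dots> \<le> L powr (1 / (real t - 1))"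
    using \<open>B \<ge> 1\<close> \<open>B \<le> L\<close> assms by (intro powr_mono2) auto
  finally have L2: "real m / real t \<le> L powr (1 / (real t - 1))" .
  have "?c * ?a * real (max_antichain t m 1) \<le> (real t * real m * L) * L * real t"
  proof (intro mult_mono)
    show "?c \<le> real t * real m * L"
      using c_le mult_left_mono[OF a_le, of "real t * real m"] by simp
    show "real (max_antichain t m 1) \<le> real t"
      using max_antichain_1_le by simp
  qed (use a_le \<open>B \<ge> 1\<close> \<open>B \<le> L\<close> in auto)
  also have "\<dots> = L ^ 2 * (real m / real t * real t ^ 3)"
    using pos by (simp add: field_simps power2_eq_square power3_eq_cube)
  also have "\<dots> \<le> L ^ 2 * (L powr (1 / (real t - 1)) * L powr \<epsilon>)"
    using L1 L2 pos by (intro mult_left_mono mult_mono) auto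
  also have "\<dots> = L powr (2 + 1 / (real t - 1) + \<epsilon>)"
    using \<open>B \<ge> 1\<close> \<open>B \<le> L\<close> by (simp add: powr_add powr_numeral)
  finally have "?c * ?a * real (max_antichain t m 1) \<le> L powr (2 + 1 / (real t - 1) + \<epsilon>)" .
  then have "real (card (Q t m 3)) * (?c * ?a * real (max_antichain t m 1))
      \<le> real (card (Q t m 3)) * L powr (2 + 1 / (real t - 1) + \<epsilon>)"
    by (rule mult_left_mono) simp
  then show ?thesis
    by (simp add: L_def mult.assoc)
qed

section \<open>Growth along the sequence of posets and the bound for k at least 4\<close>

text \<open>The three claims support each other: a large antichain in one poset makes the next poset
  at least the square of its size, which in turn makes the largest antichain there at least a cube
  root. One threshold \<open>X\<close> serves all \<open>j\<close>.\<close>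

lemma Q_growth:
  fixes X :: real
  assumes X: "\<And>x. x \<ge> X \<Longrightarrow> x\<^sup>2 \<le> 2 powr (x powr (1/3)) \<and> x + 1 \<le> x powr (4/3)"
    and "t \<ge> 2" "m \<ge> 2" "X \<le> real (t * m)" and large: "real t powr 3 \<le> real m ^ (t - 1)"
    and "j \<ge> 2"
  shows "max X 4 \<le> real (card (Q t m j)) \<and>
    real (card (Q t m j)) powr (1/3) \<le> real (max_antichain t m j) \<and>
    real (\<Prod>i = 1..j. max_antichain t m i) \<le> real (card (Q t m j)) ^ 2"
  using \<open>j \<ge> 2\<close>
proof (induction j rule: nat_induct_at_least)
  case base
  let ?c = "real (card (Q t m 2))" and ?a = "real (max_antichain t m 2)"
  have tm: "real t \<ge> 2" "real m \<ge> 2"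
    using assms by auto
  have t3: "real t ^ 3 \<le> real m ^ (t - 1)"
    using large tm by (simp add: powr_numeral)
  have mt: "real m ^ t \<le> ?c"
    using assms by (intro of_nat_power_le_card_Q_2)
  have "real t \<le> real t ^ 3"
    using tm by (intro self_le_power) auto
  then have "real t \<le> real m ^ (t - 1)"
    using t3 by linarith
  then have "real m * real t \<le> real m * real m ^ (t - 1)"
    by (rule mult_left_mono) simp
  also have "\<dots> = real m ^ t"
    using assms by (cases t) auto
  also note mt
  finally have tmc: "real t * real m \<le> ?c"
    by (simp add: mult.commute)
  have "2 * 2 \<le> real t * real m"
    using tm by (intro mult_mono) auto
  then have 1: "max X 4 \<le> ?c"
    using tmc assms by auto
  \<comment> \<open>Bounding the cube by the square of \<open>?c\<close> yields
    \<open>t * m <= ?c powr (2/3)\<close>, so \<open>?c <= t * m * ?a\<close> leaves exponent 1/3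
    for \<open>?a\<close>.\<close>
  have "(real t * real m) ^ 3 = real t ^ 3 * real m ^ 3"
    by (simp add: power_mult_distrib)
  also have "\<dots> \<le> real m ^ (t - 1) * real m ^ (t + 1)"
    using t3 tm assms by (intro mult_mono power_increasing) auto
  also have "\<dots> = (real m ^ t)\<^sup>2"
  proof -
    have "(t - 1) + (t + 1) = t * 2"
      using assms by simp
    then show ?thesis
      by (simp only: power_add[symmetric] power_mult[symmetric])
  qed
  also have "\<dots> \<le> ?c\<^sup>2"
    using mt by (intro power_mono) auto
  finally have "((real t * real m) ^ 3) powr (1/3) \<le> (?c\<^sup>2) powr (1/3)"
    by (intro powr_mono2) auto
  moreover have "0 < real t * real m" "0 < ?c"
    using tm 1 by auto
  ultimately have "real t * real m \<le> ?c powr (2/3)"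
    by (simp only: power_powr) simp
  then have "?c powr (1/3) * (real t * real m) \<le> ?c powr (1/3) * ?c powr (2/3)"
    by (rule mult_left_mono) simp
  also have "\<dots> = ?c"
    by (simp add: powr_add[symmetric])
  also have "\<dots> \<le> real t * real m * ?a"
    using assms by (intro card_Q_2_le_max_antichain)
  finally have "(real t * real m) * ?c powr (1/3) \<le> (real t * real m) * ?a"
    by (simp add: mult.commute)
  then have 2: "?c powr (1/3) \<le> ?a"
    using tm by (simp only: mult_le_cancel_left_pos[OF mult_pos_pos])
  have "real t * 1 \<le> real t * real m"
    using tm by (intro mult_left_mono) auto
  then have "real (max_antichain t m 1) \<le> ?c"
    using max_antichain_1_le[of t m] tmc by simp
  then have "real (max_antichain t m 1) * ?a \<le> ?c * ?c"
    using max_antichain_le_card by (intro mult_mono) auto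
  moreover have "{1..2} = {1, 2::nat}"
    by auto
  ultimately show ?case
    using 1 2 by (simp add: power2_eq_square)
next
  case (Suc j)
  let ?c = "real (card (Q t m j))" and ?d = "real (card (Q t m (Suc j)))"
  let ?a = "real (max_antichain t m (Suc j))"
  have c4: "?c \<ge> 4" and cX: "?c \<ge> X"
    using Suc.IH by auto
  have "?c\<^sup>2 \<le> 2 powr (?c powr (1/3))"
    using X[OF cX] by simp
  also have "\<dots> \<le> 2 powr real (max_antichain t m j)"
    using Suc.IH by (intro powr_mono) auto
  also have "\<dots> = real (2 ^ max_antichain t m j)"
    by (simp add: powr_realpow)
  also have "\<dots> \<le> ?d"
    using two_power_max_antichain_le[of j t m] Suc.hyps by (subst of_nat_le_iff) simp
  finally have cd: "?c\<^sup>2 \<le> ?d" .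
  have "?c * 1 \<le> ?c * ?c"
    using c4 by (intro mult_left_mono) auto
  then have "?c \<le> ?d"
    using cd unfolding power2_eq_square by linarith
  then have 1: "max X 4 \<le> ?d"
    using Suc.IH by linarith
  \<comment> \<open>The number of possible sizes of a down-set is at most
    \<open>?d powr (2/3)\<close>, so some size class has at least \<open>?d powr (1/3)\<close>
    members.\<close>
  have "?c + 1 \<le> ?c powr (4/3)"
    using X[OF cX] by simp
  also have "\<dots> = (?c\<^sup>2) powr (2/3)"
    using c4 by (simp add: power_powr)
  also have "\<dots> \<le> ?d powr (2/3)"
    using cd by (intro powr_mono2) auto
  finally have c1: "?c + 1 \<le> ?d powr (2/3)" .
  have "?d powr (2/3) * ?d powr (1/3) = ?d"
    by (simp add: powr_add[symmetric])
  also have "\<dots> \<le> (?c + 1) * ?a"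
    using Suc.hyps by (intro of_nat_card_Q_Suc_le) simp
  also have "\<dots> \<le> ?d powr (2/3) * ?a"
    using c1 by (rule mult_right_mono) simp
  finally have 2: "?d powr (1/3) \<le> ?a"
    using 1 by simp
  have "real (\<Prod>i = 1..Suc j. max_antichain t m i) = real (\<Prod>i = 1..j. max_antichain t m i) * ?a"
    by simp
  also have "\<dots> \<le> ?d * ?d"
  proof (rule mult_mono)
    show "real (\<Prod>i = 1..j. max_antichain t m i) \<le> ?d"
      using Suc.IH cd by linarith
    show "?a \<le> ?d"
      using max_antichain_le_card by simp
  qed simp_all
  finally show ?case
    using 1 2 by (simp add: power2_eq_square)
qed

text \<open>Here everything but two factors \<open>L\<close> is bounded by \<open>?x ^ 4\<close>,
  with \<open>?x\<close> the size of the poset two levels below \<open>k\<close>. Since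
  \<open>L\<close> is at least exponential in the cube root of \<open>?x\<close>, up to the divisor
  \<open>?x + 1\<close>, this power is absorbed by \<open>L powr \<epsilon>\<close>.\<close>

lemma bound_for_k_ge_4:
  fixes X :: real
  assumes X: "\<And>x. x \<ge> X \<Longrightarrow> x\<^sup>2 \<le> 2 powr (x powr (1/3)) \<and> x + 1 \<le> x powr (4/3) \<and>
      1 \<le> 2 powr (x powr (1/3)) / (x + 1) \<and> x ^ 4 \<le> (2 powr (x powr (1/3)) / (x + 1)) powr \<epsilon>"
    and "t \<ge> 2" "m \<ge> 2" "X \<le> real (t * m)" and large: "real t powr 3 \<le> real m ^ (t - 1)"
    and "k \<ge> 4" "\<epsilon> > 0"
  shows "real (card (Q t m k) * card (Q t m (k - 1)) * (\<Prod>i = 1..k - 1. max_antichain t m i))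
    \<le> real (card (Q t m k)) * (log 2 (real (card (Q t m k)))) powr (2 + \<epsilon>)"
proof -
  obtain j where j: "k = Suc (Suc j)" "j \<ge> 2"
    using \<open>k \<ge> 4\<close> by (cases k; cases "k - 1") auto
  define L where "L = log 2 (real (card (Q t m k)))"
  let ?x = "real (card (Q t m j))" and ?d = "real (card (Q t m (Suc j)))"
  let ?a = "real (max_antichain t m (Suc j))" and ?P = "real (\<Prod>i = 1..j. max_antichain t m i)"
  \<comment> \<open>A lower bound for \<open>?a\<close>, from
    \<open>2 powr (?x powr (1/3)) <= ?d <= (?x + 1) * ?a\<close>.\<close>
  define B where "B = 2 powr (?x powr (1/3)) / (?x + 1)"
  have grow: "max X 4 \<le> ?x" "?x powr (1/3) \<le> real (max_antichain t m j)" "?P \<le> ?x ^ 2"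
    using Q_growth[of X t m j] X assms(2-5) j(2) by blast+
  have B: "1 \<le> B" "?x ^ 4 \<le> B powr \<epsilon>"
    using X[of ?x] grow(1) by (auto simp: B_def)
  have a_le: "?a \<le> L"
    using max_antichain_le_log_card[of "Suc j" t m] by (simp add: L_def j)
  have d_le: "?d \<le> (?x + 1) * ?a"
    using j(2) by (intro of_nat_card_Q_Suc_le) simp
  have "2 powr (?x powr (1/3)) \<le> 2 powr real (max_antichain t m j)"
    using grow(2) by (intro powr_mono) auto
  also have "\<dots> = real (2 ^ max_antichain t m j)"
    by (simp add: powr_realpow)
  also have "\<dots> \<le> ?d"
    using two_power_max_antichain_le[of j t m] j(2) by (subst of_nat_le_iff) simp
  finally have "2 powr (?x powr (1/3)) \<le> (?x + 1) * ?a"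
    using d_le by simp
  then have "B \<le> ?a"
    by (simp add: B_def divide_le_eq mult.commute)
  then have L: "B \<le> L" "L \<ge> 1"
    using a_le B(1) by auto
  have "4 * ?x \<le> ?x * ?x"
    using grow(1) by (intro mult_right_mono) auto
  moreover have "?x \<ge> 4"
    using grow(1) by simp
  ultimately have x1: "?x + 1 \<le> ?x ^ 2"
    unfolding power2_eq_square by linarith
  have "?d * (?P * ?a) \<le> (?x ^ 2 * L) * (?x ^ 2 * L)"
  proof (intro mult_mono)
    have "(?x + 1) * ?a \<le> ?x ^ 2 * L"
      using x1 a_le L by (intro mult_mono) auto
    then show "?d \<le> ?x ^ 2 * L"
      using d_le by simp
  qed (use grow a_le L in \<open>auto intro!: mult_nonneg_nonneg prod_nonneg\<close>)
  also have "\<dots> = ?x ^ 4 * L ^ 2"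
    by (simp add: power_mult_distrib power2_eq_square power4_eq_xxxx)
  also have "\<dots> \<le> L powr \<epsilon> * L ^ 2"
  proof (rule mult_right_mono)
    have "B powr \<epsilon> \<le> L powr \<epsilon>"
      using B L \<open>\<epsilon> > 0\<close> by (intro powr_mono2) auto
    then show "?x ^ 4 \<le> L powr \<epsilon>"
      using B(2) by simp
  qed simp
  also have "\<dots> = L powr (2 + \<epsilon>)"
    using L by (simp add: powr_add powr_numeral)
  finally have "real (card (Q t m k)) * (?d * (?P * ?a)) \<le> real (card (Q t m k)) * L powr (2 + \<epsilon>)"
    by (rule mult_left_mono) simp
  then show ?thesis
    by (simp add: L_def j mult.assoc del: Q.simps)
qed

text \<open>The first two conditions drive the induction in \<open>Q_growth\<close>; the last two
  absorb the fourth power in \<open>bound_for_k_ge_4\<close>.\<close>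

lemma eventually_growth_conditions:
  fixes \<epsilon> :: real
  assumes "\<epsilon> > 0"
  shows "\<exists>X. \<forall>x\<ge>X. x\<^sup>2 \<le> 2 powr (x powr (1/3)) \<and> x + 1 \<le> x powr (4/3) \<and>
      1 \<le> 2 powr (x powr (1/3)) / (x + 1) \<and> x ^ 4 \<le> (2 powr (x powr (1/3)) / (x + 1)) powr \<epsilon>"
proof -
  have "\<forall>\<^sub>F x::real in at_top. x\<^sup>2 \<le> 2 powr (x powr (1/3))"
    by real_asymp
  moreover have "\<forall>\<^sub>F x::real in at_top. x + 1 \<le> x powr (4/3)"
    by real_asymp
  moreover have "\<forall>\<^sub>F x::real in at_top. 1 \<le> 2 powr (x powr (1/3)) / (x + 1)"
    by real_asymp
  moreover have "\<forall>\<^sub>F x::real in at_top. x ^ 4 \<le> (2 powr (x powr (1/3)) / (x + 1)) powr \<epsilon>"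
    using assms by real_asymp
  ultimately have "\<forall>\<^sub>F x in at_top. x\<^sup>2 \<le> 2 powr (x powr (1/3)) \<and> x + 1 \<le> x powr (4/3) \<and>
      1 \<le> 2 powr (x powr (1/3)) / (x + 1) \<and> x ^ 4 \<le> (2 powr (x powr (1/3)) / (x + 1)) powr \<epsilon>"
    by eventually_elim blast
  then show ?thesis
    by (simp add: eventually_at_top_linorder)
qed

theorem theorem10:
  shows "(\<forall>k m t r :: nat. k \<ge> 2 \<and> m \<ge> 2 \<and> t \<ge> 2 \<and> r = k + m - 1 \<longrightarrow>
           online_size_ramsey k t (tight_path k r)
             \<le> enat (card (Q t m k) * card (Q t m (k - 1)) * (\<Prod>i = 1..k - 1. max_antichain t m i)))
       \<and> (\<forall>\<epsilon> :: real. \<epsilon> > 0 \<longrightarrow> (\<exists>M :: nat. \<forall>t m :: nat. t \<ge> 2 \<and> m \<ge> 2 \<and> t * m \<ge> M \<longrightarrow>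
            real (card (Q t m 3) * card (Q t m 2) * max_antichain t m 2 * max_antichain t m 1)
              \<le> real (card (Q t m 3))
                  * (log 2 (real (card (Q t m 3)))) powr (2 + 1 / (real t - 1) + \<epsilon>)
          \<and> (\<forall>k :: nat. k \<ge> 4 \<longrightarrow>
              real (card (Q t m k) * card (Q t m (k - 1)) * (\<Prod>i = 1..k - 1. max_antichain t m i))
                \<le> real (card (Q t m k)) * (log 2 (real (card (Q t m k)))) powr (2 + \<epsilon>))))"
proof (rule conjI; intro allI impI)
  fix k m t r :: nat
  assume "k \<ge> 2 \<and> m \<ge> 2 \<and> t \<ge> 2 \<and> r = k + m - 1"
  then show "online_size_ramsey k t (tight_path k r)
      \<le> enat (card (Q t m k) * card (Q t m (k - 1)) * (\<Prod>i = 1..k - 1. max_antichain t m i))"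
    using online_size_ramsey_tight_path_le by blast
next
  fix \<epsilon> :: real assume \<epsilon>: "\<epsilon> > 0"
  obtain M1 where M1: "\<And>t m. t \<ge> 2 \<Longrightarrow> m \<ge> 2 \<Longrightarrow> t * m \<ge> M1 \<Longrightarrow>
      real t powr (3 / \<epsilon> + 1) \<le> real m ^ (t - 1)"
    using powr_le_power_of_product_ge[of "3 / \<epsilon> + 1"] \<epsilon> by (auto simp: add_pos_pos)
  obtain M2 where M2: "\<And>t m. t \<ge> 2 \<Longrightarrow> m \<ge> 2 \<Longrightarrow> t * m \<ge> M2 \<Longrightarrow>
      real t powr 3 \<le> real m ^ (t - 1)"
    using powr_le_power_of_product_ge[of 3] by auto
  obtain X where X: "\<And>x. x \<ge> X \<Longrightarrow> x\<^sup>2 \<le> 2 powr (x powr (1/3)) \<and> x + 1 \<le> x powr (4/3) \<and>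
      1 \<le> 2 powr (x powr (1/3)) / (x + 1) \<and> x ^ 4 \<le> (2 powr (x powr (1/3)) / (x + 1)) powr \<epsilon>"
    using eventually_growth_conditions[OF \<epsilon>] by blast
  show "\<exists>M :: nat. \<forall>t m :: nat. t \<ge> 2 \<and> m \<ge> 2 \<and> t * m \<ge> M \<longrightarrow>
            real (card (Q t m 3) * card (Q t m 2) * max_antichain t m 2 * max_antichain t m 1)
              \<le> real (card (Q t m 3))
                  * (log 2 (real (card (Q t m 3)))) powr (2 + 1 / (real t - 1) + \<epsilon>)
          \<and> (\<forall>k :: nat. k \<ge> 4 \<longrightarrow>
              real (card (Q t m k) * card (Q t m (k - 1)) * (\<Prod>i = 1..k - 1. max_antichain t m i))
                \<le> real (card (Q t m k)) * (log 2 (real (card (Q t m k)))) powr (2 + \<epsilon>))"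
  \<comment> \<open>\<open>M1\<close> serves the case of three levels, \<open>M2\<close> starts the
    induction over the levels, and the last entry gives \<open>X <= t * m\<close>. None of them
    depends on \<open>k\<close>.\<close>
  proof (rule exI[of _ "max (max M1 M2) (nat \<lceil>X\<rceil>)"], intro allI impI conjI)
    fix t m :: nat
    assume tm: "t \<ge> 2 \<and> m \<ge> 2 \<and> t * m \<ge> max (max M1 M2) (nat \<lceil>X\<rceil>)"
    then show "real (card (Q t m 3) * card (Q t m 2) * max_antichain t m 2 * max_antichain t m 1)
        \<le> real (card (Q t m 3)) * (log 2 (real (card (Q t m 3)))) powr (2 + 1 / (real t - 1) + \<epsilon>)"
      using M1 \<epsilon> by (intro bound_for_k_3) auto
    fix k :: nat assume k: "k \<ge> 4"
    have "nat \<lceil>X\<rceil> \<le> t * m"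
      using tm by simp
    then have "X \<le> real (t * m)"
      by linarith
    then show "real (card (Q t m k) * card (Q t m (k - 1)) * (\<Prod>i = 1..k - 1. max_antichain t m i))
        \<le> real (card (Q t m k)) * (log 2 (real (card (Q t m k)))) powr (2 + \<epsilon>)"
      using X M2 tm k \<epsilon> by (intro bound_for_k_ge_4) auto
  qed
qed

end
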